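(* For every $b>0$, $$\xi(C_b)=\Xi(b),\qquad \nu(C_b)=\mathrm N(b),$$ where for $0<b\le 1$ $$\Xi(b)=\frac{8b^2(7-3b)}{105},\qquad \mathrm N(b)=\frac{4b(28-9b)}{105},$$ and for $b>1$, with $\gamma:=\sqrt{\frac{b-1}{b}}$, $$\Xi(b)=\frac{183\gamma-38b\gamma-88b^2\gamma+112b^2+48b^3\gamma-48b^3-\frac{105\operatorname{acosh}(\sqrt b)}{b}}{210},$$ $$\mathrm N(b)=\frac{\frac{87\gamma}{b}+250\gamma-376b\gamma+448b+144b^2\gamma-144b^2-\frac{105\operatorname{acosh}(\sqrt b)}{b^2}}{420}.$$ For each of $\Xi$ and $\mathrm N$ the expressions in the two cases agree at $b=1$, where $\xi(C_1)=\frac{32}{105}$ and $\nu(C_1)=\frac{76}{105}$.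
   Context: A (bivariate) copula is a distribution function on $[0,1]^2$ with uniform marginals. $\partial_1 C$ denotes the partial derivative of $C$ in its first argument (it exists almost everywhere). Chatterjee's rank correlation of a copula $C$ is $$\xi(C):=6\int_0^1\!\!\int_0^1(\partial_1C(t,v))^2\,\mathrm dt\,\mathrm dv-2,$$ and Blest's rank correlation is $$\nu(C):=24\int_0^1\!\!\int_0^1(1-u)\,C(u,v)\,\mathrm du\,\mathrm dv-2.$$ The family $(C_b)_{b>0}$: write $\operatorname{clamp}(y,\alpha,\beta):=\min\{\max\{y,\alpha\},\beta\}$ for $\alpha<\beta$. For $b>0$ and $v\in[0,1]$ let $q(v)=q_b(v)\in[-1/b,1]$ be the unique number with $\int_0^1\operatorname{clamp}\bigl(b((1-t)^2-q(v)),0,1\bigr)\,\mathrm dt=v$ (existence and uniqueness hold). Put $h_b(t,v):=\operatorname{clamp}\bigl(b((1-t)^2-q(v)),0,1\bigr)$ and $$C_b(u,v):=\int_0^u h_b(t,v)\,\mathrm dt,\qquad (u,v)\in[0,1]^2.$$ Each $C_b$ is a copula, with $\partial_1C_b=h_b$. $\operatorname{acosh}(x)=\log(x+\sqrt{x^2-1})$ for $x\ge1$. *)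

theory Defs
  imports "HOL-Analysis.Analysis"
begin

(* Not the library's clamp, which has another argument order and acts on vectors;
   meant for alpha < beta. *)
definition clip :: "real \<Rightarrow> real \<Rightarrow> real \<Rightarrow> real" where
  "clip y \<alpha> \<beta> = min (max y \<alpha>) \<beta>"

(* Bivariate copulas are represented by functions real => real => real of which only the
   values on the unit square matter. *)

(* Where the partial derivative does not exist, deriv has an unspecified value. For a copula
   this affects, for each v, only a null set of t, hence not the integral; the same holds for
   t = 0 and t = 1, where deriv looks at values outside the unit square. *)
definition partial1 :: "(real \<Rightarrow> real \<Rightarrow> real) \<Rightarrow> real \<Rightarrow> real \<Rightarrow> real" where
  "partial1 C t v = deriv (\<lambda>s. C s v) t"

definition chatterjee_xi :: "(real \<Rightarrow> real \<Rightarrow> real) \<Rightarrow> real" where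
  "chatterjee_xi C =
     6 * integral {0..1} (\<lambda>v. integral {0..1} (\<lambda>t. (partial1 C t v)\<^sup>2)) - 2"

definition blest_nu :: "(real \<Rightarrow> real \<Rightarrow> real) \<Rightarrow> real" where
  "blest_nu C =
     24 * integral {0..1} (\<lambda>v. integral {0..1} (\<lambda>u. (1 - u) * C u v)) - 2"

(* For b > 0 and v in [0,1] there is exactly one such number. *)
definition q_fun :: "real \<Rightarrow> real \<Rightarrow> real" where
  "q_fun b v = (THE q. q \<in> {- (1 / b)..1} \<and>
     integral {0..1} (\<lambda>t. clip (b * ((1 - t)\<^sup>2 - q)) 0 1) = v)"

definition h_fun :: "real \<Rightarrow> real \<Rightarrow> real \<Rightarrow> real" where
  "h_fun b t v = clip (b * ((1 - t)\<^sup>2 - q_fun b v)) 0 1"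

definition C_fam :: "real \<Rightarrow> real \<Rightarrow> real \<Rightarrow> real" where
  "C_fam b u v = integral {0..u} (\<lambda>t. h_fun b t v)"

definition gam :: "real \<Rightarrow> real" where
  "gam b = sqrt ((b - 1) / b)"

definition Xi_small :: "real \<Rightarrow> real" where
  "Xi_small b = 8 * b^2 * (7 - 3 * b) / 105"

definition Xi_large :: "real \<Rightarrow> real" where
  "Xi_large b =
     (183 * gam b - 38 * b * gam b - 88 * b^2 * gam b + 112 * b^2
       + 48 * b^3 * gam b - 48 * b^3 - 105 * arcosh (sqrt b) / b) / 210"

definition Xi :: "real \<Rightarrow> real" where
  "Xi b = (if b \<le> 1 then Xi_small b else Xi_large b)"

definition Nu_small :: "real \<Rightarrow> real" where
  "Nu_small b = 4 * b * (28 - 9 * b) / 105"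

definition Nu_large :: "real \<Rightarrow> real" where
  "Nu_large b =
     (87 * gam b / b + 250 * gam b - 376 * b * gam b + 448 * b
       + 144 * b^2 * gam b - 144 * b^2 - 105 * arcosh (sqrt b) / b^2) / 420"

definition Nu :: "real \<Rightarrow> real" where
  "Nu b = (if b \<le> 1 then Nu_small b else Nu_large b)"

end

theory Submission
  imports Defs
begin

text \<open>
  Put x = 1 - t. For fixed q, the function clamp (b (x^2 - q), 0, 1) of x is 0 up to
  s = \<open>lower_cut q\<close>, equals b (x^2 - q) up to r = \<open>upper_cut b q\<close>, and is 1 afterwards. Its
  integral F(q) decreases from 1 to 0 with F'(q) = -b (r - s), so the substitution v = F(q) undoes
  the implicitly defined q(v): the two coefficients become integrals over q in [-1/b, 1] of
  b (r - s) times the integral over x of the squared clamp for \<open>\<xi>\<close> and, after an integration by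
  parts in u, of x^2 times the clamp for \<open>\<nu>\<close>. Between the points 0 and 1 - 1/b, where one of the
  cuts reaches the boundary of [0, 1], these have elementary antiderivatives. For b > 1 the middle
  interval has r^2 = s^2 + 1/b, and a term ln (s + r) there produces the acosh.
\<close>

section \<open>Cut points of the clamp and its integrals over x\<close>

definition lower_cut :: "real \<Rightarrow> real" where
  "lower_cut q = sqrt (max q 0)"

text \<open>Truncation at 0 in \<open>lower_cut\<close> and at 1 here keeps both cuts in [0, 1] for
  q in [-1/b, 1], so one formula serves every position of q relative to 0 and 1 - 1/b.\<close>

definition upper_cut :: "real \<Rightarrow> real \<Rightarrow> real" where
  "upper_cut b q = sqrt (min 1 (q + 1 / b))"

text \<open>This is the F of the outline; \<open>square_clip\<close> and \<open>moment_clip\<close>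
  are its analogues for the squared clamp and for x^2 times the clamp. Each adds the integral of a
  polynomial between the cuts to the integral of 1 or x^2 over [r, 1].\<close>

definition mean_clip :: "real \<Rightarrow> real \<Rightarrow> real" where
  "mean_clip b q = (let s = lower_cut q; r = upper_cut b q in
     b * ((r^3 - s^3) / 3 - q * (r - s)) + 1 - r)"

definition square_clip :: "real \<Rightarrow> real \<Rightarrow> real" where
  "square_clip b q = (let s = lower_cut q; r = upper_cut b q in
     b^2 * ((r^5 - s^5) / 5 - 2 * q * (r^3 - s^3) / 3 + q^2 * (r - s)) + 1 - r)"

definition moment_clip :: "real \<Rightarrow> real \<Rightarrow> real" where
  "moment_clip b q = (let s = lower_cut q; r = upper_cut b q in
     b * ((r^5 - s^5) / 5 - q * (r^3 - s^3) / 3) + (1 - r^3) / 3)"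

lemma cuts_ordered:
  assumes "0 < b" "q \<in> {- (1 / b)..1}"
  shows "0 \<le> lower_cut q" "lower_cut q \<le> upper_cut b q" "upper_cut b q \<le> 1"
  using assms unfolding lower_cut_def upper_cut_def by (auto simp: min_def max_def)

text \<open>Strictness away from the ends makes the weight b (r - s) positive there, hence F
  strictly decreasing.\<close>

lemma cuts_strict:
  assumes "0 < b" "q \<in> {- (1 / b)<..<1}"
  shows "lower_cut q < upper_cut b q"
  using assms unfolding lower_cut_def upper_cut_def by (auto simp: min_def max_def)

lemma continuous_on_cuts:
  "continuous_on A lower_cut" "continuous_on A (upper_cut b)"
  unfolding lower_cut_def [abs_def] upper_cut_def [abs_def] by (intro continuous_intros)+

lemma has_integral_antiderivative:
  fixes f F :: "real \<Rightarrow> real"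
  assumes "a \<le> c" "\<And>x. (F has_real_derivative f x) (at x)"
  shows "(f has_integral (F c - F a)) {a..c}"
  using assms
  by (intro fundamental_theorem_of_calculus)
     (auto simp: has_real_derivative_iff_has_vector_derivative [symmetric] intro: DERIV_subset)

text \<open>With \<open>p x y\<close> being y, y^2 or x^2 y, the three integrals share one case
  distinction: \<open>F\<close>, \<open>G\<close>, \<open>H\<close> are antiderivatives for the
  values 0, b (x^2 - q) and 1 that the clamp takes on the three pieces.\<close>

lemma has_integral_clip_pieces:
  assumes b: "0 < b" and q: "q \<in> {- (1 / b)..1}"
    and F: "\<And>x. (F has_real_derivative p x 0) (at x)"
    and G: "\<And>x. (G has_real_derivative p x (b * (x\<^sup>2 - q))) (at x)"
    and H: "\<And>x. (H has_real_derivative p x 1) (at x)"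
  shows "((\<lambda>x. p x (clip (b * (x\<^sup>2 - q)) 0 1)) has_integral
    (F (lower_cut q) - F 0) + (G (upper_cut b q) - G (lower_cut q))
      + (H 1 - H (upper_cut b q))) {0..1}"
proof -
  let ?s = "lower_cut q" and ?r = "upper_cut b q"
  note ord = cuts_ordered [OF b q]
  have s2: "?s\<^sup>2 = max q 0"
    by (simp add: lower_cut_def)
  have r2: "?r\<^sup>2 = min 1 (q + 1 / b)"
    using q by (simp add: upper_cut_def)
  \<comment> \<open>The cut itself is excluded: for q < 0 it is 0, where the clamp is positive.
    Likewise in \<open>above\<close>: for q > 1 - 1/b the upper cut is 1, where the clamp is below
    1.\<close>
  have below: "clip (b * (x\<^sup>2 - q)) 0 1 = 0" if "x \<in> {0..?s} - {?s}" for x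
  proof -
    have "x\<^sup>2 < ?s\<^sup>2"
      using that by (intro power_strict_mono) auto
    then have "x\<^sup>2 \<le> q"
      using s2 zero_le_power2 [of x] by (auto simp: max_def split: if_splits)
    then have "b * (x\<^sup>2 - q) \<le> 0"
      using b by (simp add: mult_le_0_iff)
    then show ?thesis
      by (simp add: clip_def max_def min_def)
  qed
  have between: "clip (b * (x\<^sup>2 - q)) 0 1 = b * (x\<^sup>2 - q)" if "x \<in> {?s..?r}" for x
  proof -
    have "?s\<^sup>2 \<le> x\<^sup>2" "x\<^sup>2 \<le> ?r\<^sup>2"
      using that ord by (auto intro!: power_mono)
    then have "0 \<le> x\<^sup>2 - q" "x\<^sup>2 - q \<le> 1 / b"
      using s2 r2 by auto
    then have "0 \<le> b * (x\<^sup>2 - q)" "b * (x\<^sup>2 - q) \<le> 1"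
      using b by (auto simp: field_simps)
    then show ?thesis
      by (simp add: clip_def)
  qed
  have above: "clip (b * (x\<^sup>2 - q)) 0 1 = 1" if "x \<in> {?r..1} - {?r}" for x
  proof -
    \<comment> \<open>A point strictly above r forces r < 1, so the truncation at 1 is inactive and
      r^2 = q + 1/b.\<close>
    have "?r < 1" "?r\<^sup>2 \<le> x\<^sup>2"
      using that ord by (auto intro!: power_mono)
    then have "1 / b \<le> x\<^sup>2 - q"
      using r2 by (auto simp: min_def upper_cut_def split: if_splits)
    then have "1 \<le> b * (x\<^sup>2 - q)"
      using b by (simp add: field_simps)
    then show ?thesis
      by (simp add: clip_def)
  qed
  have "((\<lambda>x. p x (clip (b * (x\<^sup>2 - q)) 0 1)) has_integral (F ?s - F 0)) {0..?s}"
    using has_integral_antiderivative [OF ord(1) F]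
    by (rule has_integral_spike_finite [of "{?s}", rotated 2]) (use below in auto)
  moreover have "((\<lambda>x. p x (clip (b * (x\<^sup>2 - q)) 0 1)) has_integral (G ?r - G ?s)) {?s..?r}"
    using has_integral_antiderivative [OF ord(2) G]
    by (rule has_integral_eq [rotated]) (use between in auto)
  moreover have "((\<lambda>x. p x (clip (b * (x\<^sup>2 - q)) 0 1)) has_integral (H 1 - H ?r)) {?r..1}"
    using has_integral_antiderivative [OF ord(3) H]
    by (rule has_integral_spike_finite [of "{?r}", rotated 2]) (use above in auto)
  ultimately show ?thesis
    using ord by (meson has_integral_combine order_trans)
qed

lemma has_integral_mean_clip:
  assumes b: "0 < b" and q: "q \<in> {- (1 / b)..1}"
  shows "((\<lambda>x. clip (b * (x\<^sup>2 - q)) 0 1) has_integral mean_clip b q) {0..1}"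
proof (rule back_subst [where P = "\<lambda>i. (_ has_integral i) _"],
    rule has_integral_clip_pieces [OF b q, where p = "\<lambda>x y. y" and F = "\<lambda>_. 0"
      and G = "\<lambda>x. b * (x^3 / 3 - q * x)" and H = "\<lambda>x. x"])
  show "((\<lambda>x. b * (x^3 / 3 - q * x)) has_real_derivative b * (x\<^sup>2 - q)) (at x)" for x
    by (rule derivative_eq_intros refl | simp)+
qed (auto simp: mean_clip_def Let_def algebra_simps diff_divide_distrib)

lemma has_integral_square_clip:
  assumes b: "0 < b" and q: "q \<in> {- (1 / b)..1}"
  shows "((\<lambda>x. (clip (b * (x\<^sup>2 - q)) 0 1)\<^sup>2) has_integral square_clip b q) {0..1}"
proof (rule back_subst [where P = "\<lambda>i. (_ has_integral i) _"],
    rule has_integral_clip_pieces [OF b q, where p = "\<lambda>x y. y\<^sup>2" and F = "\<lambda>_. 0"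
      and G = "\<lambda>x. b^2 * (x^5 / 5 - 2 * q * x^3 / 3 + q^2 * x)" and H = "\<lambda>x. x"])
  show "((\<lambda>x. b^2 * (x^5 / 5 - 2 * q * x^3 / 3 + q^2 * x)) has_real_derivative
      (b * (x\<^sup>2 - q))\<^sup>2) (at x)" for x
    by (rule derivative_eq_intros refl | simp)+
       (simp add: algebra_simps power2_eq_square power4_eq_xxxx)
qed (auto simp: square_clip_def Let_def algebra_simps diff_divide_distrib)

lemma has_integral_moment_clip:
  assumes b: "0 < b" and q: "q \<in> {- (1 / b)..1}"
  shows "((\<lambda>x. x\<^sup>2 * clip (b * (x\<^sup>2 - q)) 0 1) has_integral moment_clip b q) {0..1}"
proof (rule back_subst [where P = "\<lambda>i. (_ has_integral i) _"],
    rule has_integral_clip_pieces [OF b q, where p = "\<lambda>x y. x\<^sup>2 * y" and F = "\<lambda>_. 0"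
      and G = "\<lambda>x. b * (x^5 / 5 - q * x^3 / 3)" and H = "\<lambda>x. x^3 / 3"])
  show "((\<lambda>x. b * (x^5 / 5 - q * x^3 / 3)) has_real_derivative
      x\<^sup>2 * (b * (x\<^sup>2 - q))) (at x)" for x
    by (rule derivative_eq_intros refl | simp)+
       (simp add: algebra_simps power2_eq_square power4_eq_xxxx)
  show "((\<lambda>x. x^3 / 3) has_real_derivative x\<^sup>2 * 1) (at x)" for x :: real
    by (rule derivative_eq_intros refl | simp)+
qed (auto simp: moment_clip_def Let_def algebra_simps diff_divide_distrib)

section \<open>Continuity, derivative and strict monotonicity of F in q\<close>

lemma continuous_on_clip_integrals:
  "continuous_on A (mean_clip b)" "continuous_on A (square_clip b)"
  "continuous_on A (moment_clip b)"
  unfolding mean_clip_def [abs_def] square_clip_def [abs_def] moment_clip_def [abs_def] Let_def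
  by (intro continuous_intros continuous_on_cuts; simp)+

text \<open>The derivative is written through the cut itself, so that later computations stay
  rational in the cuts; \<open>upper_cut_sqrt\<close> does the same for r.\<close>

lemma lower_cut_sqrt:
  assumes "0 < q"
  shows "0 < lower_cut q" "(lower_cut q)\<^sup>2 = q"
    "(lower_cut has_real_derivative 1 / (2 * lower_cut q)) (at q)"
proof -
  show pos: "0 < lower_cut q" and sq: "(lower_cut q)\<^sup>2 = q"
    using assms by (simp_all add: lower_cut_def)
  have "(lower_cut has_real_derivative inverse (sqrt q) / 2) (at q)"
    by (rule has_field_derivative_transform_within_open [of sqrt _ _ "{0<..}"])
       (use assms in \<open>auto simp: lower_cut_def max_def intro!: DERIV_real_sqrt\<close>)
  then show "(lower_cut has_real_derivative 1 / (2 * lower_cut q)) (at q)"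
    using assms by (simp add: lower_cut_def field_simps)
qed

lemma upper_cut_sqrt:
  assumes "- (1 / b) < q" "q < 1 - 1 / b"
  shows "0 < upper_cut b q" "(upper_cut b q)\<^sup>2 = q + 1 / b"
    "(upper_cut b has_real_derivative 1 / (2 * upper_cut b q)) (at q)"
proof -
  show "0 < upper_cut b q" and "(upper_cut b q)\<^sup>2 = q + 1 / b"
    using assms by (simp_all add: upper_cut_def)
  have "(upper_cut b has_real_derivative inverse (sqrt (q + 1 / b)) / 2) (at q)"
    by (rule has_field_derivative_transform_within_open
          [of "\<lambda>q. sqrt (q + 1 / b)" _ _ "{..<1 - 1 / b}"])
       (use assms in \<open>auto simp: upper_cut_def min_def intro!: derivative_eq_intros\<close>)
  then show "(upper_cut b has_real_derivative 1 / (2 * upper_cut b q)) (at q)"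
    using assms by (simp add: upper_cut_def field_simps)
qed

text \<open>Either the cut is locally constant and d = 0, or its square is q. The product equation
  records both cases at once, in the form in which d enters the derivative of F.\<close>

lemma lower_cut_has_derivative:
  assumes "q \<noteq> 0"
  obtains d where "(lower_cut has_real_derivative d) (at q)" "((lower_cut q)\<^sup>2 - q) * d = 0"
proof (cases "q < 0")
  case True
  have "(lower_cut has_real_derivative 0) (at q)"
    by (rule has_field_derivative_transform_within_open [of "\<lambda>_. 0" _ _ "{..<0}"])
       (use True in \<open>auto simp: lower_cut_def max_def\<close>)
  then show ?thesis
    using that by auto
next
  case False
  with assms have "0 < q"
    by simp
  from lower_cut_sqrt [OF this] show ?thesis
    using that by auto
qed

text \<open>As for the lower cut: either r = 1 locally and the derivative is 0, or r^2 = q +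
  1/b.\<close>

lemma upper_cut_has_derivative:
  assumes "- (1 / b) < q" "q \<noteq> 1 - 1 / b"
  obtains d where "(upper_cut b has_real_derivative d) (at q)"
    "((upper_cut b q)\<^sup>2 - q - 1 / b) * d = 0"
proof (cases "1 - 1 / b < q")
  case True
  have "(upper_cut b has_real_derivative 0) (at q)"
    by (rule has_field_derivative_transform_within_open [of "\<lambda>_. 1" _ _ "{1 - 1 / b<..}"])
       (use True in \<open>auto simp: upper_cut_def min_def\<close>)
  then show ?thesis
    using that by auto
next
  case False
  with assms have "q < 1 - 1 / b"
    by auto
  from upper_cut_sqrt [OF assms(1) this] show ?thesis
    using that by auto
qed

text \<open>The terms with the derivatives of the cuts cancel because the truncated function is
  continuous across them.\<close>

lemma mean_clip_has_derivative:
  assumes b: "0 < b" and q: "- (1 / b) < q" "q \<noteq> 0" "q \<noteq> 1 - 1 / b"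
  shows "(mean_clip b has_real_derivative - (b * (upper_cut b q - lower_cut q))) (at q)"
proof -
  obtain d where d: "(lower_cut has_real_derivative d) (at q)" "((lower_cut q)\<^sup>2 - q) * d = 0"
    using q by (rule_tac lower_cut_has_derivative)
  obtain e where e: "(upper_cut b has_real_derivative e) (at q)"
      "((upper_cut b q)\<^sup>2 - q - 1 / b) * e = 0"
    using q by (rule_tac upper_cut_has_derivative)
  have e2: "b * (((upper_cut b q)\<^sup>2 - q) * e) = e"
    using e(2) b by (simp add: field_simps)
  let ?s = "lower_cut q" and ?r = "upper_cut b q"
  have "(mean_clip b has_real_derivative
      b * ((3 * ?r^2 * e - 3 * ?s^2 * d) / 3 - ((?r - ?s) + q * (e - d))) - e) (at q)"
    unfolding mean_clip_def [abs_def] Let_def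
    by (rule derivative_eq_intros d(1) e(1) refl | simp)+
  also have "b * ((3 * ?r^2 * e - 3 * ?s^2 * d) / 3 - ((?r - ?s) + q * (e - d))) - e =
      - (b * (?r - ?s)) + (b * ((?r^2 - q) * e) - e) - b * ((?s^2 - q) * d)"
    by (simp add: algebra_simps diff_divide_distrib)
  finally show ?thesis
    using d(2) e2 by simp
qed

lemma mean_clip_ends:
  assumes "0 < b"
  shows "mean_clip b (- (1 / b)) = 1" "mean_clip b 1 = 0"
  using assms by (simp_all add: mean_clip_def Let_def lower_cut_def upper_cut_def)


lemma mean_clip_has_integral:
  assumes b: "0 < b" and q: "- (1 / b) \<le> p" "p \<le> q"
  shows "((\<lambda>q. b * (upper_cut b q - lower_cut q)) has_integral
    (mean_clip b p - mean_clip b q)) {p..q}"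
proof -
  have "((\<lambda>q. - (b * (upper_cut b q - lower_cut q))) has_integral
      (mean_clip b q - mean_clip b p)) {p..q}"
    \<comment> \<open>A cut fails to be differentiable at 0 and at 1 - 1/b; finitely many such
      points are harmless because F is continuous.\<close>
    by (rule fundamental_theorem_of_calculus_interior_strong [of "{0, 1 - 1 / b}"])
       (use q in \<open>auto simp: has_real_derivative_iff_has_vector_derivative [symmetric]
          intro!: mean_clip_has_derivative b continuous_on_clip_integrals\<close>)
  from has_integral_neg [OF this] show ?thesis
    by simp
qed

lemma mean_clip_strict_antimono:
  assumes b: "0 < b" and q: "- (1 / b) \<le> p" "p < q" "q \<le> 1"
  shows "mean_clip b q < mean_clip b p"
proof -
  let ?w = "\<lambda>q. b * (upper_cut b q - lower_cut q)"
  have w: "(?w has_integral (mean_clip b p - mean_clip b q)) {p..q}"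
    using mean_clip_has_integral assms by simp
  have nonneg: "0 \<le> ?w x" if "x \<in> {p..q}" for x
    using that q b cuts_ordered(2) [OF b, of x] by simp
  have "mean_clip b p - mean_clip b q \<noteq> 0"
  proof
    assume "mean_clip b p - mean_clip b q = 0"
    then have "integral {p..q} ?w = 0"
      using integral_unique [OF w] by simp
    moreover have "continuous_on {p..q} ?w"
      by (intro continuous_intros continuous_on_cuts)
    \<comment> \<open>A continuous nonnegative function with integral 0 vanishes everywhere. The
      midpoint lies inside (-1/b, 1), whereas the cuts coincide at the two ends.\<close>
    ultimately have "?w ((p + q) / 2) = 0"
      using integral_eq_0_iff [of p q ?w] nonneg q by auto
    then show False
      using cuts_strict [OF b, of "(p + q) / 2"] b q by auto
  qed
  moreover have "0 \<le> mean_clip b p - mean_clip b q"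
    using w nonneg by (rule has_integral_nonneg)
  ultimately show ?thesis
    by simp
qed

text \<open>Differentiability is asked for only inside: the pieces meet at 0 and 1 - 1/b, where a
  cut has no derivative.\<close>

lemma has_integral_piece:
  fixes F f :: "real \<Rightarrow> real"
  assumes "p \<le> q" "continuous_on {p..q} F"
    and "\<And>x. p < x \<Longrightarrow> x < q \<Longrightarrow> (F has_real_derivative f x) (at x)"
  shows "(f has_integral (F q - F p)) {p..q}"
  using assms by (intro fundamental_theorem_of_calculus_interior)
    (auto simp: has_real_derivative_iff_has_vector_derivative [symmetric])

section \<open>The inverse q(v) of F and the substitution v = F(q)\<close>

lemma has_integral_reflect_unit:
  fixes f :: "real \<Rightarrow> real"
  assumes "(f has_integral i) {0..1}"
  shows "((\<lambda>t. f (1 - t)) has_integral i) {0..1}"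
proof -
  have img: "(\<lambda>x::real. 1 - x) ` {0..1} = {0..1}"
    by (auto intro!: image_eqI [of _ _ "1 - _"])
  show ?thesis
    using has_integral_affinity [of f i 0 1 "-1" 1] assms img by simp
qed

text \<open>Strict monotonicity of F supplies the uniqueness that the definite description in
  \<open>q_fun\<close> requires.\<close>

lemma q_fun_mean_clip:
  assumes b: "0 < b" and q: "q \<in> {- (1 / b)..1}"
  shows "q_fun b (mean_clip b q) = q"
  unfolding q_fun_def
proof (rule the_equality)
  have eq: "integral {0..1} (\<lambda>t. clip (b * ((1 - t)\<^sup>2 - p)) 0 1) = mean_clip b p"
    if "p \<in> {- (1 / b)..1}" for p
    using has_integral_reflect_unit [OF has_integral_mean_clip [OF b that]]
    by (rule integral_unique)
  then show "q \<in> {- (1 / b)..1} \<and>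
      integral {0..1} (\<lambda>t. clip (b * ((1 - t)\<^sup>2 - q)) 0 1) = mean_clip b q"
    using q by simp
  fix p
  assume "p \<in> {- (1 / b)..1} \<and>
      integral {0..1} (\<lambda>t. clip (b * ((1 - t)\<^sup>2 - p)) 0 1) = mean_clip b q"
  then have "p \<in> {- (1 / b)..1}" "mean_clip b p = mean_clip b q"
    using eq by auto
  then show "p = q"
    using mean_clip_strict_antimono [OF b, of p q] mean_clip_strict_antimono [OF b, of q p] q
    by (cases p q rule: linorder_cases) auto
qed

text \<open>Monotonicity and the values at the ends give one inclusion. The intermediate value
  theorem gives the other, which is the existence of q(v) for all v in [0, 1].\<close>

lemma mean_clip_image:
  assumes b: "0 < b"
  shows "mean_clip b ` {- (1 / b)..1} = {0..1}"
proof
  have le: "- (1 / b) \<le> 1"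
    using b by (simp add: order_trans [of _ 0])
  show "mean_clip b ` {- (1 / b)..1} \<subseteq> {0..1}"
  proof safe
    fix q assume "q \<in> {- (1 / b)..1}"
    then show "mean_clip b q \<in> {0..1}"
      using mean_clip_strict_antimono [OF b, of "- (1 / b)" q]
        mean_clip_strict_antimono [OF b, of q 1] mean_clip_ends [OF b]
      by (cases "q = - (1 / b)"; cases "q = 1") auto
  qed
  show "{0..1} \<subseteq> mean_clip b ` {- (1 / b)..1}"
  proof
    fix v :: real assume "v \<in> {0..1}"
    then obtain q where "- (1 / b) \<le> q" "q \<le> 1" "mean_clip b q = v"
      using IVT2' [of "mean_clip b" 1 v "- (1 / b)"] mean_clip_ends [OF b] le
        continuous_on_clip_integrals(1) by auto
    then show "v \<in> mean_clip b ` {- (1 / b)..1}"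
      by auto
  qed
qed

lemma q_fun_range:
  assumes "0 < b" "v \<in> {0..1}"
  shows "q_fun b v \<in> {- (1 / b)..1}"
  using assms mean_clip_image [of b] q_fun_mean_clip [of b] by (metis imageE)

text \<open>A continuous injection on a compact interval has a continuous inverse. The substitution
  rule needs this for its integrand.\<close>

lemma continuous_on_q_fun:
  assumes b: "0 < b"
  shows "continuous_on {0..1} (q_fun b)"
  using continuous_on_inv [of "{- (1 / b)..1}" "mean_clip b" "q_fun b"]
    continuous_on_clip_integrals(1) q_fun_mean_clip [OF b] mean_clip_image [OF b]
  by auto

text \<open>Substituting v = F(q) removes the implicit function, since \<open>q_fun\<close> inverts
  F, and F' contributes the weight b (r - s).\<close>

lemma integral_q_fun:
  fixes g :: "real \<Rightarrow> real"
  assumes b: "0 < b" and g: "continuous_on {- (1 / b)..1} g"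
    and int: "((\<lambda>q. b * (upper_cut b q - lower_cut q) * g q) has_integral I) {- (1 / b)..1}"
  shows "integral {0..1} (\<lambda>v. g (q_fun b v)) = I"
proof -
  have le: "- (1 / b) \<le> 1"
    using b by (simp add: order_trans [of _ 0])
  \<comment> \<open>The rule yields a difference of two integrals, one for each orientation. As F
    runs from 1 down to 0, the first one is over an empty interval, and the minus sign matches that
    of F'.\<close>
  have "((\<lambda>q. - (b * (upper_cut b q - lower_cut q)) *\<^sub>R g (q_fun b (mean_clip b q))) has_integral
     (integral {mean_clip b (- (1 / b))..mean_clip b 1} (\<lambda>v. g (q_fun b v))
      - integral {mean_clip b 1..mean_clip b (- (1 / b))} (\<lambda>v. g (q_fun b v)))) {- (1 / b)..1}"
  proof (rule has_integral_substitution_general [where c = 0 and d = 1 and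
        s = "{- (1 / b), 0, 1 - 1 / b}" and f = "\<lambda>v. g (q_fun b v)" and g = "mean_clip b"])
    show "continuous_on {0..1} (\<lambda>v. g (q_fun b v))"
      using g continuous_on_q_fun [OF b]
      by (rule continuous_on_compose2) (intro image_subsetI q_fun_range [OF b])
    show "(mean_clip b has_real_derivative - (b * (upper_cut b q - lower_cut q)))
        (at q within {- (1 / b)..1})" if "q \<in> {- (1 / b)..1} - {- (1 / b), 0, 1 - 1 / b}" for q
      by (rule has_field_derivative_at_within, rule mean_clip_has_derivative [OF b])
         (use that in auto)
    show "mean_clip b ` {- (1 / b)..1} \<subseteq> {0..1}"
      unfolding mean_clip_image [OF b] ..
  qed (simp, rule le, rule continuous_on_clip_integrals)
  then have "((\<lambda>q. - (b * (upper_cut b q - lower_cut q)) *\<^sub>R g (q_fun b (mean_clip b q))) has_integral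
      - integral {0..1} (\<lambda>v. g (q_fun b v))) {- (1 / b)..1}"
    by (simp add: mean_clip_ends [OF b])
  then have "((\<lambda>q. - (b * (upper_cut b q - lower_cut q) * g q)) has_integral
      - integral {0..1} (\<lambda>v. g (q_fun b v))) {- (1 / b)..1}"
    by (rule has_integral_eq [rotated]) (simp add: q_fun_mean_clip [OF b])
  from has_integral_unique [OF this has_integral_neg [OF int]] show ?thesis
    by simp
qed

section \<open>Reduction of \<xi> and \<nu> to integrals over q\<close>

lemma continuous_on_h_fun: "continuous_on A (\<lambda>t. h_fun b t v)"
  unfolding h_fun_def clip_def by (intro continuous_intros)

lemma C_fam_has_derivative:
  assumes "t \<in> {0<..<1}"
  shows "((\<lambda>u. C_fam b u v) has_real_derivative h_fun b t v) (at t)"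
  using integral_has_real_derivative [OF continuous_on_h_fun, of t 0 1 b v] assms
  unfolding C_fam_def by (simp add: at_within_Icc_at)

text \<open>The inner integral depends on v only through q(v), so the outer one can be taken over q
  by \<open>integral_q_fun\<close>.\<close>

lemma chatterjee_xi_C_fam:
  assumes b: "0 < b"
    and int: "((\<lambda>q. b * (upper_cut b q - lower_cut q) * square_clip b q) has_integral I)
      {- (1 / b)..1}"
  shows "chatterjee_xi (C_fam b) = 6 * I - 2"
proof -
  have "integral {0..1} (\<lambda>t. (partial1 (C_fam b) t v)\<^sup>2) = square_clip b (q_fun b v)"
    if v: "v \<in> {0..1}" for v
  proof (rule integral_unique, rule has_integral_spike_finite [of "{0, 1}"])
    show "((\<lambda>t. (h_fun b t v)\<^sup>2) has_integral square_clip b (q_fun b v)) {0..1}"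
      unfolding h_fun_def
      using has_integral_reflect_unit [OF has_integral_square_clip [OF b q_fun_range [OF b v]]] .
    \<comment> \<open>At the two end points \<open>partial1\<close> looks outside the unit square;
      they do not affect the integral.\<close>
    show "(partial1 (C_fam b) t v)\<^sup>2 = (h_fun b t v)\<^sup>2" if "t \<in> {0..1} - {0, 1}" for t
      using DERIV_imp_deriv [OF C_fam_has_derivative, of t b v] that
      by (simp add: partial1_def)
  qed simp
  then have "integral {0..1} (\<lambda>v. integral {0..1} (\<lambda>t. (partial1 (C_fam b) t v)\<^sup>2)) =
      integral {0..1} (\<lambda>v. square_clip b (q_fun b v))"
    by (rule integral_cong)
  also have "\<dots> = I"
    using b continuous_on_clip_integrals(2) int by (rule integral_q_fun)
  finally show ?thesis
    by (simp add: chatterjee_xi_def)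
qed

text \<open>Since 1 - u has the antiderivative -(1 - u)^2 / 2, the weight on \<open>h_fun\<close> is
  (1 - u)^2 / 2, and the factor 24 becomes 12.\<close>

lemma blest_nu_C_fam:
  assumes b: "0 < b"
    and int: "((\<lambda>q. b * (upper_cut b q - lower_cut q) * moment_clip b q) has_integral I)
      {- (1 / b)..1}"
  shows "blest_nu (C_fam b) = 12 * I - 2"
proof -
  have "integral {0..1} (\<lambda>u. (1 - u) * C_fam b u v) = moment_clip b (q_fun b v) / 2"
    if v: "v \<in> {0..1}" for v
  proof (rule integral_unique)
    \<comment> \<open>Integration by parts; the boundary terms vanish.\<close>
    define D where "D u = - ((1 - u)\<^sup>2 / 2) * C_fam b u v" for u
    have "continuous_on {0..1} (\<lambda>u. C_fam b u v)"
      unfolding C_fam_def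
      by (intro indefinite_integral_continuous_1 integrable_continuous_interval
          continuous_on_h_fun)
    then have "continuous_on {0..1} D"
      unfolding D_def [abs_def] by (intro continuous_intros; simp)
    moreover have "(D has_real_derivative
        (1 - u) * C_fam b u v - (1 - u)\<^sup>2 * h_fun b u v / 2) (at u)" if "u \<in> {0<..<1}" for u
    proof -
      have "((\<lambda>u. - ((1 - u)\<^sup>2 / 2)) has_real_derivative 1 - u) (at u)"
        by (rule derivative_eq_intros refl | simp add: field_simps)+
      from DERIV_mult [OF this C_fam_has_derivative [OF that]] show ?thesis
        unfolding D_def [abs_def] by (simp add: algebra_simps)
    qed
    ultimately have "((\<lambda>u. (1 - u) * C_fam b u v - (1 - u)\<^sup>2 * h_fun b u v / 2) has_integral
        (D 1 - D 0)) {0..1}"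
      by (intro has_integral_piece) auto
    moreover have "((\<lambda>u. (1 - u)\<^sup>2 * h_fun b u v / 2) has_integral
        moment_clip b (q_fun b v) / 2) {0..1}"
      unfolding h_fun_def
      by (rule has_integral_divide, rule has_integral_reflect_unit
          [OF has_integral_moment_clip [OF b q_fun_range [OF b v]]])
    ultimately have "((\<lambda>u. (1 - u) * C_fam b u v - (1 - u)\<^sup>2 * h_fun b u v / 2
        + (1 - u)\<^sup>2 * h_fun b u v / 2) has_integral
        D 1 - D 0 + moment_clip b (q_fun b v) / 2) {0..1}"
      by (rule has_integral_add)
    \<comment> \<open>\<open>D\<close> vanishes at 1 through its factor (1 - u)^2 and at 0 because
      the integral defining \<open>C_fam\<close> is over a single point.\<close>
    then show "((\<lambda>u. (1 - u) * C_fam b u v) has_integral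
        moment_clip b (q_fun b v) / 2) {0..1}"
      by (simp add: D_def C_fam_def)
  qed
  then have "integral {0..1} (\<lambda>v. integral {0..1} (\<lambda>u. (1 - u) * C_fam b u v)) =
      integral {0..1} (\<lambda>v. moment_clip b (q_fun b v) / 2)"
    by (rule integral_cong)
  also have "\<dots> = I / 2"
    using integral_q_fun [OF b continuous_on_clip_integrals(3) int] by simp
  finally show ?thesis
    by (simp add: blest_nu_def)
qed

section \<open>Antiderivatives in q on the three intervals\<close>

lemma lower_cut_0: "q \<le> 0 \<Longrightarrow> lower_cut q = 0"
  by (simp add: lower_cut_def)

lemma upper_cut_1: "1 - 1 / b \<le> q \<Longrightarrow> upper_cut b q = 1"
  by (simp add: upper_cut_def)

text \<open>The sum of the derivatives 1/(2s) and 1/(2r) is (s + r)/(2sr), so s + r cancels in the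
  logarithmic derivative.\<close>

lemma ln_cuts_has_derivative:
  assumes "0 < b" "0 < q" "q < 1 - 1 / b"
  shows "((\<lambda>q. ln (lower_cut q + upper_cut b q)) has_real_derivative
    1 / (2 * lower_cut q * upper_cut b q)) (at q)"
proof -
  let ?s = "lower_cut q" and ?r = "upper_cut b q"
  have q: "- (1 / b) < q"
    using assms by (simp add: order_less_trans [of _ 0])
  note s = lower_cut_sqrt [OF assms(2)] and r = upper_cut_sqrt [OF q assms(3)]
  have "((\<lambda>q. ln (lower_cut q + upper_cut b q)) has_real_derivative
      (1 / (2 * ?s) + 1 / (2 * ?r)) / (?s + ?r)) (at q)"
    using s(1) r(1) by (auto intro!: derivative_eq_intros s(3) r(3))
  also have "(1 / (2 * ?s) + 1 / (2 * ?r)) / (?s + ?r) = 1 / (2 * ?s * ?r)"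
  proof -
    have "1 / (2 * ?s) + 1 / (2 * ?r) = (?s + ?r) / (2 * ?s * ?r)"
      using s(1) r(1) by (simp add: field_simps)
    then show ?thesis
      using s(1) r(1) by simp
  qed
  finally show ?thesis .
qed

text \<open>
  Antiderivatives on the three intervals, on the left in terms of r (where s = 0) and on the right
  in terms of s (where r = 1). The product s r times a quadratic polynomial in q, which occurs in
  the middle interval for b > 1, is integrated by the ansatz s r P(q) - k ln (s + r) with P cubic.
\<close>

definition xi_left :: "real \<Rightarrow> real \<Rightarrow> real" where
  "xi_left b r = 2 * b * (b^2 * r^8 / 15 - 2 * b * r^6 / 9 + r^3 / 3)"

definition xi_mid :: "real \<Rightarrow> real \<Rightarrow> real" where
  "xi_mid b q = (let s = lower_cut q; r = upper_cut b q in
     4 / 15 * b^3 * q^4 + 4 / 45 * b^2 * q^3 - 8 / 15 * b * q^2 - 4 / 5 * q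
     + 2 / 3 * b * (r^3 - s^3)
     + s * r * (- 4 / 15 * b^3 * q^3 + 2 / 45 * b^2 * q^2 + 43 / 90 * b * q + 1 / 12)
     - 1 / (12 * b) * ln (s + r))"

definition xi_right :: "real \<Rightarrow> real \<Rightarrow> real" where
  "xi_right b s = 2 * b^3 * (s^2 / 10 - s^3 / 15 - s^4 / 6 + 2 * s^5 / 15 + s^6 / 6
     - 23 * s^7 / 105 + s^8 / 15)"

definition nu_left :: "real \<Rightarrow> real \<Rightarrow> real" where
  "nu_left b r = 2 * b * (r^3 / 9 - b * r^8 / 60)"

definition nu_mid :: "real \<Rightarrow> real \<Rightarrow> real" where
  "nu_mid b q = (let s = lower_cut q; r = upper_cut b q in
     - (b^2 * (r^8 + s^8) / 30) + 2 / 9 * b * (r^3 - s^3)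
     + s * r * (b^2 * q^3 / 15 + b * q^2 / 10 + 3 / 40 * q + 1 / (48 * b))
     - 1 / (48 * b^2) * ln (s + r))"

definition nu_right :: "real \<Rightarrow> real \<Rightarrow> real" where
  "nu_right b s = 2 * b^2 * (s^2 / 10 - s^3 / 15 - s^4 / 12 + s^5 / 15 + 2 * s^7 / 105 - s^8 / 60)"

text \<open>The chain rule for a polynomial in a cut r brings the factor 1/(2r). Clearing it leaves
  a polynomial identity to check.\<close>

lemma has_derivative_rescale:
  fixes d e r :: real
  assumes "(F has_real_derivative d * (1 / (2 * r))) (at x)" "d = 2 * r * e" "0 < r"
  shows "(F has_real_derivative e) (at x)"
  using assms by simp

text \<open>The two upper bounds on q let one statement serve b <= 1, where the left interval ends
  at 1 - 1/b, and b > 1, where it ends at 0.\<close>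

lemma has_integral_left:
  assumes b: "0 < b" and p: "- (1 / b) \<le> p" "p \<le> q" "q \<le> 0" "q \<le> 1 - 1 / b"
  shows "((\<lambda>q. b * (upper_cut b q - lower_cut q) * square_clip b q) has_integral
      xi_left b (upper_cut b q) - xi_left b (upper_cut b p)) {p..q}"
    and "((\<lambda>q. b * (upper_cut b q - lower_cut q) * moment_clip b q) has_integral
      nu_left b (upper_cut b q) - nu_left b (upper_cut b p)) {p..q}"
proof -
  have cont: "continuous_on {p..q} (\<lambda>x. xi_left b (upper_cut b x))"
    "continuous_on {p..q} (\<lambda>x. nu_left b (upper_cut b x))"
    unfolding xi_left_def nu_left_def by (intro continuous_intros continuous_on_cuts; simp)+
  have deriv: "((\<lambda>x. xi_left b (upper_cut b x)) has_real_derivative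
      b * (upper_cut b x - lower_cut x) * square_clip b x) (at x)"
    "((\<lambda>x. nu_left b (upper_cut b x)) has_real_derivative
      b * (upper_cut b x - lower_cut x) * moment_clip b x) (at x)"
    if "p < x" "x < q" for x
  proof -
    let ?r = "upper_cut b x"
    have x: "- (1 / b) < x" "x < 1 - 1 / b"
      using that p by auto
    note r = upper_cut_sqrt [OF x]
    have s: "lower_cut x = 0"
      using that p by (simp add: lower_cut_0)
    \<comment> \<open>Together with s = 0 this eliminates x, leaving identities in b and r.\<close>
    have bx: "b * x = b * ?r\<^sup>2 - 1"
      using r(2) b by (simp add: field_simps)
    have "((\<lambda>x. xi_left b (upper_cut b x)) has_real_derivative
        2 * b * (8 * b^2 * ?r^7 / 15 - 12 * b * ?r^5 / 9 + ?r^2) * (1 / (2 * ?r))) (at x)"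
      unfolding xi_left_def
      by (rule derivative_eq_intros r(3) refl | simp add: algebra_simps)+
    moreover have "2 * b * (8 * b^2 * ?r^7 / 15 - 12 * b * ?r^5 / 9 + ?r^2) =
        2 * ?r * (b * (?r - lower_cut x) * square_clip b x)"
    proof -
      have "square_clip b x = b^2 * (?r^5 / 5 - 2 * x * ?r^3 / 3 + x^2 * ?r) + 1 - ?r"
        by (simp add: square_clip_def s Let_def)
      then show ?thesis
        using bx unfolding s by algebra
    qed
    ultimately show "((\<lambda>x. xi_left b (upper_cut b x)) has_real_derivative
      b * (upper_cut b x - lower_cut x) * square_clip b x) (at x)"
      using r(1) by (rule has_derivative_rescale)
    have "((\<lambda>x. nu_left b (upper_cut b x)) has_real_derivative
        2 * b * (?r^2 / 3 - 8 * b * ?r^7 / 60) * (1 / (2 * ?r))) (at x)"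
      unfolding nu_left_def
      by (rule derivative_eq_intros r(3) refl | simp add: algebra_simps)+
    moreover have "2 * b * (?r^2 / 3 - 8 * b * ?r^7 / 60) =
        2 * ?r * (b * (?r - lower_cut x) * moment_clip b x)"
    proof -
      have "moment_clip b x = b * (?r^5 / 5 - x * ?r^3 / 3) + (1 - ?r^3) / 3"
        by (simp add: moment_clip_def s Let_def)
      then show ?thesis
        using bx unfolding s by algebra
    qed
    ultimately show "((\<lambda>x. nu_left b (upper_cut b x)) has_real_derivative
      b * (upper_cut b x - lower_cut x) * moment_clip b x) (at x)"
      using r(1) by (rule has_derivative_rescale)
  qed
  show "((\<lambda>q. b * (upper_cut b q - lower_cut q) * square_clip b q) has_integral
      xi_left b (upper_cut b q) - xi_left b (upper_cut b p)) {p..q}"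
    by (rule has_integral_piece [OF p(2) cont(1) deriv(1)])
  show "((\<lambda>q. b * (upper_cut b q - lower_cut q) * moment_clip b q) has_integral
      nu_left b (upper_cut b q) - nu_left b (upper_cut b p)) {p..q}"
    by (rule has_integral_piece [OF p(2) cont(2) deriv(2)])
qed

text \<open>Here r = 1 and q = s^2, so everything is polynomial in s. The interval starts at 0 for b
  <= 1 and at 1 - 1/b for b > 1.\<close>

lemma has_integral_right:
  assumes b: "0 < b" and p: "0 \<le> p" "1 - 1 / b \<le> p" "p \<le> 1"
  shows "((\<lambda>q. b * (upper_cut b q - lower_cut q) * square_clip b q) has_integral
      xi_right b 1 - xi_right b (lower_cut p)) {p..1}"
    and "((\<lambda>q. b * (upper_cut b q - lower_cut q) * moment_clip b q) has_integral
      nu_right b 1 - nu_right b (lower_cut p)) {p..1}"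
proof -
  have cont: "continuous_on {p..1} (\<lambda>x. xi_right b (lower_cut x))"
    "continuous_on {p..1} (\<lambda>x. nu_right b (lower_cut x))"
    unfolding xi_right_def nu_right_def by (intro continuous_intros continuous_on_cuts; simp)+
  have deriv: "((\<lambda>x. xi_right b (lower_cut x)) has_real_derivative
      b * (upper_cut b x - lower_cut x) * square_clip b x) (at x)"
    "((\<lambda>x. nu_right b (lower_cut x)) has_real_derivative
      b * (upper_cut b x - lower_cut x) * moment_clip b x) (at x)"
    if "p < x" "x < 1" for x
  proof -
    let ?s = "lower_cut x"
    have "0 < x"
      using that p by auto
    note s = lower_cut_sqrt [OF this]
    have r: "upper_cut b x = 1"
      using that p by (simp add: upper_cut_1)
    have "((\<lambda>x. xi_right b (lower_cut x)) has_real_derivative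
        2 * b^3 * (?s / 5 - ?s^2 / 5 - 2 * ?s^3 / 3 + 2 * ?s^4 / 3 + ?s^5 - 23 * ?s^6 / 15
          + 8 * ?s^7 / 15) * (1 / (2 * ?s))) (at x)"
      unfolding xi_right_def
      by (rule derivative_eq_intros s(3) refl | simp add: algebra_simps)+
    moreover have "2 * b^3 * (?s / 5 - ?s^2 / 5 - 2 * ?s^3 / 3 + 2 * ?s^4 / 3 + ?s^5
          - 23 * ?s^6 / 15 + 8 * ?s^7 / 15) =
        2 * ?s * (b * (upper_cut b x - ?s) * square_clip b x)"
    proof -
      have "square_clip b x = b^2 * ((1 - ?s^5) / 5 - 2 * x * (1 - ?s^3) / 3 + x^2 * (1 - ?s))"
        by (simp add: square_clip_def r Let_def)
      then show ?thesis
        using s(2) unfolding r by algebra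
    qed
    ultimately show "((\<lambda>x. xi_right b (lower_cut x)) has_real_derivative
      b * (upper_cut b x - lower_cut x) * square_clip b x) (at x)"
      using s(1) by (rule has_derivative_rescale)
    have "((\<lambda>x. nu_right b (lower_cut x)) has_real_derivative
        2 * b^2 * (?s / 5 - ?s^2 / 5 - ?s^3 / 3 + ?s^4 / 3 + 2 * ?s^6 / 15 - 2 * ?s^7 / 15)
          * (1 / (2 * ?s))) (at x)"
      unfolding nu_right_def
      by (rule derivative_eq_intros s(3) refl | simp add: algebra_simps)+
    moreover have "2 * b^2 * (?s / 5 - ?s^2 / 5 - ?s^3 / 3 + ?s^4 / 3 + 2 * ?s^6 / 15
          - 2 * ?s^7 / 15) =
        2 * ?s * (b * (upper_cut b x - ?s) * moment_clip b x)"
    proof -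
      have "moment_clip b x = b * ((1 - ?s^5) / 5 - x * (1 - ?s^3) / 3)"
        by (simp add: moment_clip_def r Let_def)
      then show ?thesis
        using s(2) unfolding r by algebra
    qed
    ultimately show "((\<lambda>x. nu_right b (lower_cut x)) has_real_derivative
      b * (upper_cut b x - lower_cut x) * moment_clip b x) (at x)"
      using s(1) by (rule has_derivative_rescale)
  qed
  have 1: "lower_cut 1 = 1"
    by (simp add: lower_cut_def)
  show "((\<lambda>q. b * (upper_cut b q - lower_cut q) * square_clip b q) has_integral
      xi_right b 1 - xi_right b (lower_cut p)) {p..1}"
    using has_integral_piece [OF p(3) cont(1) deriv(1)] by (simp add: 1)
  show "((\<lambda>q. b * (upper_cut b q - lower_cut q) * moment_clip b q) has_integral
      nu_right b 1 - nu_right b (lower_cut p)) {p..1}"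
    using has_integral_piece [OF p(3) cont(2) deriv(2)] by (simp add: 1)
qed

text \<open>With s = 0 and r = 1 the integrands are polynomials in q. Their antiderivatives vanish
  at 0, so only the value at 1 - 1/b remains.\<close>

lemma has_integral_mid_small:
  assumes b: "0 < b" "b \<le> 1"
  shows "((\<lambda>q. b * (upper_cut b q - lower_cut q) * square_clip b q) has_integral
      - (b^3 * ((1 - 1 / b) / 5 - (1 - 1 / b)^2 / 3 + (1 - 1 / b)^3 / 3))) {1 - 1 / b..0}"
    and "((\<lambda>q. b * (upper_cut b q - lower_cut q) * moment_clip b q) has_integral
      - (b^2 * ((1 - 1 / b) / 5 - (1 - 1 / b)^2 / 6))) {1 - 1 / b..0}"
proof -
  have le: "1 - 1 / b \<le> 0"
    using b by simp
  have cuts: "upper_cut b x = 1" "lower_cut x = 0" if "1 - 1 / b < x" "x < 0" for x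
    using that by (auto simp: upper_cut_1 lower_cut_0)
  have "((\<lambda>q. b * (upper_cut b q - lower_cut q) * square_clip b q) has_integral
      b^3 * (0 / 5 - 0^2 / 3 + 0^3 / 3)
      - b^3 * ((1 - 1 / b) / 5 - (1 - 1 / b)^2 / 3 + (1 - 1 / b)^3 / 3)) {1 - 1 / b..0}"
  proof (rule has_integral_piece [OF le])
    fix x assume x: "1 - 1 / b < x" "x < 0"
    show "((\<lambda>x. b^3 * (x / 5 - x^2 / 3 + x^3 / 3)) has_real_derivative
        b * (upper_cut b x - lower_cut x) * square_clip b x) (at x)"
      unfolding square_clip_def cuts [OF x] Let_def
      by (rule derivative_eq_intros refl | simp)+ (simp add: power3_eq_cube power2_eq_square algebra_simps)
  qed (intro continuous_intros; simp)
  then show "((\<lambda>q. b * (upper_cut b q - lower_cut q) * square_clip b q) has_integral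
      - (b^3 * ((1 - 1 / b) / 5 - (1 - 1 / b)^2 / 3 + (1 - 1 / b)^3 / 3))) {1 - 1 / b..0}"
    by simp
  have "((\<lambda>q. b * (upper_cut b q - lower_cut q) * moment_clip b q) has_integral
      b^2 * (0 / 5 - 0^2 / 6)
      - b^2 * ((1 - 1 / b) / 5 - (1 - 1 / b)^2 / 6)) {1 - 1 / b..0}"
  proof (rule has_integral_piece [OF le])
    fix x assume x: "1 - 1 / b < x" "x < 0"
    show "((\<lambda>x. b^2 * (x / 5 - x^2 / 6)) has_real_derivative
        b * (upper_cut b x - lower_cut x) * moment_clip b x) (at x)"
      unfolding moment_clip_def cuts [OF x] Let_def
      by (rule derivative_eq_intros refl | simp)+ (simp add: power2_eq_square algebra_simps)
  qed (intro continuous_intros; simp)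
  then show "((\<lambda>q. b * (upper_cut b q - lower_cut q) * moment_clip b q) has_integral
      - (b^2 * ((1 - 1 / b) / 5 - (1 - 1 / b)^2 / 6))) {1 - 1 / b..0}"
    by simp
qed

text \<open>The product rule gives s r P' + ((r^2 + s^2) P - k) / (2 s r). The last hypothesis says
  that k makes the numerator divisible by s^2 r^2, which turns the quotient into s r R.\<close>

lemma product_ln_has_derivative:
  assumes b: "0 < b" and x: "0 < x" "x < 1 - 1 / b"
    and P: "(P has_real_derivative P') (at x)"
    and R: "((upper_cut b x)\<^sup>2 + (lower_cut x)\<^sup>2) * P x - k =
      2 * (lower_cut x * upper_cut b x)\<^sup>2 * R"
  shows "((\<lambda>q. lower_cut q * upper_cut b q * P q - k * ln (lower_cut q + upper_cut b q))
    has_real_derivative lower_cut x * upper_cut b x * (P' + R)) (at x)"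
proof -
  let ?s = "lower_cut x" and ?r = "upper_cut b x"
  have x': "- (1 / b) < x"
    using x b by (simp add: order_less_trans [of _ 0])
  note s = lower_cut_sqrt [OF x(1)] and r = upper_cut_sqrt [OF x' x(2)]
  have "((\<lambda>q. lower_cut q * upper_cut b q * P q - k * ln (lower_cut q + upper_cut b q))
      has_real_derivative (1 / (2 * ?s) * ?r + 1 / (2 * ?r) * ?s) * P x + P' * (?s * ?r)
        - 1 / (2 * ?s * ?r) * k) (at x)"
    by (rule derivative_eq_intros s(3) r(3) P ln_cuts_has_derivative [OF b x] refl | simp)+
  also have "(1 / (2 * ?s) * ?r + 1 / (2 * ?r) * ?s) * P x + P' * (?s * ?r)
        - 1 / (2 * ?s * ?r) * k =
      P' * (?s * ?r) + ((?r\<^sup>2 + ?s\<^sup>2) * P x - k) / (2 * ?s * ?r)"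
    using s(1) r(1) by (simp add: field_simps power2_eq_square)
  also have "\<dots> = ?s * ?r * (P' + R)"
    unfolding R using s(1) r(1) by (simp add: field_simps power2_eq_square)
  finally show ?thesis .
qed

lemma has_integral_mid_large:
  assumes b: "1 < b"
  shows "((\<lambda>q. b * (upper_cut b q - lower_cut q) * square_clip b q) has_integral
      xi_mid b (1 - 1 / b) - xi_mid b 0) {0..1 - 1 / b}"
    and "((\<lambda>q. b * (upper_cut b q - lower_cut q) * moment_clip b q) has_integral
      nu_mid b (1 - 1 / b) - nu_mid b 0) {0..1 - 1 / b}"
proof -
  have le: "0 \<le> 1 - 1 / b"
    using b by simp
  \<comment> \<open>Positivity of s + r up to the end points, also at 0 where s = 0, keeps the
    logarithm continuous.\<close>
  have "0 \<le> lower_cut x" "0 < upper_cut b x" if "x \<in> {0..1 - 1 / b}" for x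
    using that b by (auto simp: lower_cut_def upper_cut_def min_def add_nonneg_pos)
  then have pos: "lower_cut x + upper_cut b x \<noteq> 0" if "x \<in> {0..1 - 1 / b}" for x
    using that by fastforce
  have cont: "continuous_on {0..1 - 1 / b} (xi_mid b)" "continuous_on {0..1 - 1 / b} (nu_mid b)"
    unfolding xi_mid_def [abs_def] nu_mid_def [abs_def] Let_def
    by (intro continuous_intros continuous_on_cuts; use pos b in simp)+
  have deriv: "(xi_mid b has_real_derivative
      b * (upper_cut b x - lower_cut x) * square_clip b x) (at x)"
    "(nu_mid b has_real_derivative
      b * (upper_cut b x - lower_cut x) * moment_clip b x) (at x)"
    if x: "0 < x" "x < 1 - 1 / b" for x
  proof -
    let ?s = "lower_cut x" and ?r = "upper_cut b x"
    have x': "- (1 / b) < x"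
      using x b by (simp add: order_less_trans [of _ 0])
    note s = lower_cut_sqrt [OF x(1)] and r = upper_cut_sqrt [OF x' x(2)]
    have b0: "0 < b"
      using b by simp
    have br: "b * ?r\<^sup>2 = b * x + 1"
      using r(2) b by (simp add: field_simps)
    \<comment> \<open>The cubes account for the multiple of r - s in the expanded integrands; r^2
      and s^2 have derivative 1, hence the factors 3/2.\<close>
    have cubes: "((\<lambda>q. upper_cut b q ^ 3 - lower_cut q ^ 3) has_real_derivative
        3 / 2 * ?r - 3 / 2 * ?s) (at x)"
    proof -
      have "((\<lambda>q. upper_cut b q ^ 3) has_real_derivative 3 / 2 * ?r) (at x)"
        by (rule has_derivative_rescale [OF _ _ r(1), where d = "3 * ?r\<^sup>2"])
           (auto intro!: derivative_eq_intros r(3) simp: power2_eq_square)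
      moreover have "((\<lambda>q. lower_cut q ^ 3) has_real_derivative 3 / 2 * ?s) (at x)"
        by (rule has_derivative_rescale [OF _ _ s(1), where d = "3 * ?s\<^sup>2"])
           (auto intro!: derivative_eq_intros s(3) simp: power2_eq_square)
      ultimately show ?thesis
        by (rule DERIV_diff)
    qed
    \<comment> \<open>In the integrand for \<nu>, the relations q = s^2 and b q = b r^2 - 1 collapse
      the even powers to -2/15 b^2 (r^6 + s^6), whence r^8 + s^8 in \<open>nu_mid\<close>.\<close>
    have eighth: "((\<lambda>q. upper_cut b q ^ 8 + lower_cut q ^ 8) has_real_derivative
        4 * ?r ^ 6 + 4 * ?s ^ 6) (at x)"
    proof -
      have "((\<lambda>q. upper_cut b q ^ 8) has_real_derivative 4 * ?r ^ 6) (at x)"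
        by (rule has_derivative_rescale [OF _ _ r(1), where d = "8 * ?r ^ 7"])
           (auto intro!: derivative_eq_intros r(3) simp: eval_nat_numeral)
      moreover have "((\<lambda>q. lower_cut q ^ 8) has_real_derivative 4 * ?s ^ 6) (at x)"
        by (rule has_derivative_rescale [OF _ _ s(1), where d = "8 * ?s ^ 7"])
           (auto intro!: derivative_eq_intros s(3) simp: eval_nat_numeral)
      ultimately show ?thesis
        by (rule DERIV_add)
    qed
    \<comment> \<open>With \<open>c\<close> for 1/b and the relation b c = 1 the identities below
      become polynomial.\<close>
    define c where "c = 1 / b"
    have bc: "b * c = 1" and r2: "?r\<^sup>2 = x + c"
      using b0 r(2) by (simp_all add: c_def)
    define P where "P q = - 4 / 15 * b^3 * q^3 + 2 / 45 * b^2 * q^2 + 43 / 90 * b * q + 1 / 12" for q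
    define P' where "P' = - 4 / 5 * b^3 * x^2 + 4 / 45 * b^2 * x + 43 / 90 * b"
    have "(P has_real_derivative P') (at x)"
      unfolding P_def [abs_def] P'_def
      by (rule derivative_eq_intros refl | simp add: algebra_simps)+
    \<comment> \<open>The quadratic before \<open>- P'\<close> is the coefficient of s r in the
      integrand for \<xi> once r^2 and s^2 are expressed through x; \<open>R\<close> is this
      quadratic minus P'.\<close>
    moreover have "(?r\<^sup>2 + ?s\<^sup>2) * P x - 1 / 12 * c =
        2 * (?s * ?r)\<^sup>2 * (- 16 / 15 * b^3 * x^2 + 4 / 15 * b^2 * x + 4 / 5 * b - P')"
      using bc r2 s(2) unfolding P_def P'_def by algebra
    ultimately have mixed: "((\<lambda>q. lower_cut q * upper_cut b q * P q
        - 1 / 12 * c * ln (lower_cut q + upper_cut b q)) has_real_derivative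
        ?s * ?r * (P' + (- 16 / 15 * b^3 * x^2 + 4 / 15 * b^2 * x + 4 / 5 * b - P'))) (at x)"
      by (rule product_ln_has_derivative [OF b0 x])
    have "((\<lambda>q. 4 / 15 * b^3 * q^4 + 4 / 45 * b^2 * q^3 - 8 / 15 * b * q^2 - 4 / 5 * q
        + 2 / 3 * b * (upper_cut b q ^ 3 - lower_cut q ^ 3)
        + (lower_cut q * upper_cut b q * P q - 1 / 12 * c * ln (lower_cut q + upper_cut b q)))
      has_real_derivative 16 / 15 * b^3 * x^3 + 4 / 15 * b^2 * x^2 - 16 / 15 * b * x - 4 / 5
        + 2 / 3 * b * (3 / 2 * ?r - 3 / 2 * ?s)
        + ?s * ?r * (P' + (- 16 / 15 * b^3 * x^2 + 4 / 15 * b^2 * x + 4 / 5 * b - P'))) (at x)"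
      by (rule DERIV_add [OF DERIV_add [OF _ DERIV_cmult [OF cubes]] mixed])
         (rule derivative_eq_intros refl | simp add: algebra_simps)+
    also have "(\<lambda>q. 4 / 15 * b^3 * q^4 + 4 / 45 * b^2 * q^3 - 8 / 15 * b * q^2 - 4 / 5 * q
        + 2 / 3 * b * (upper_cut b q ^ 3 - lower_cut q ^ 3)
        + (lower_cut q * upper_cut b q * P q - 1 / 12 * c * ln (lower_cut q + upper_cut b q)))
      = xi_mid b"
      by (simp add: xi_mid_def fun_eq_iff Let_def P_def c_def)
    also have "16 / 15 * b^3 * x^3 + 4 / 15 * b^2 * x^2 - 16 / 15 * b * x - 4 / 5
        + 2 / 3 * b * (3 / 2 * ?r - 3 / 2 * ?s)
        + ?s * ?r * (P' + (- 16 / 15 * b^3 * x^2 + 4 / 15 * b^2 * x + 4 / 5 * b - P'))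
      = b * (?r - ?s) * square_clip b x"
      using br s(2) unfolding square_clip_def Let_def by algebra
    finally show "(xi_mid b has_real_derivative
      b * (upper_cut b x - lower_cut x) * square_clip b x) (at x)" .
    define Q where "Q q = b^2 * q^3 / 15 + b * q^2 / 10 + 3 / 40 * q + 1 / 48 * c" for q
    define Q' where "Q' = b^2 * x^2 / 5 + b * x / 5 + 3 / 40"
    have "(Q has_real_derivative Q') (at x)"
      unfolding Q_def [abs_def] Q'_def
      by (rule derivative_eq_intros refl | simp add: algebra_simps)+
    \<comment> \<open>The same scheme for \<nu>, where s r has the coefficient 2/15 (2 b^2 x^2 + 2 b
      x + 1).\<close>
    moreover have "(?r\<^sup>2 + ?s\<^sup>2) * Q x - 1 / 48 * c\<^sup>2 =
        2 * (?s * ?r)\<^sup>2 * (2 / 15 * (2 * b^2 * x^2 + 2 * b * x + 1) - Q')"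
      using bc r2 s(2) unfolding Q_def Q'_def by algebra
    ultimately have mixed: "((\<lambda>q. lower_cut q * upper_cut b q * Q q
        - 1 / 48 * c\<^sup>2 * ln (lower_cut q + upper_cut b q)) has_real_derivative
        ?s * ?r * (Q' + (2 / 15 * (2 * b^2 * x^2 + 2 * b * x + 1) - Q'))) (at x)"
      by (rule product_ln_has_derivative [OF b0 x])
    have "((\<lambda>q. - (b^2 * (upper_cut b q ^ 8 + lower_cut q ^ 8) / 30)
        + 2 / 9 * b * (upper_cut b q ^ 3 - lower_cut q ^ 3)
        + (lower_cut q * upper_cut b q * Q q - 1 / 48 * c\<^sup>2 * ln (lower_cut q + upper_cut b q)))
      has_real_derivative - (b^2 * (4 * ?r ^ 6 + 4 * ?s ^ 6) / 30)
        + 2 / 9 * b * (3 / 2 * ?r - 3 / 2 * ?s)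
        + ?s * ?r * (Q' + (2 / 15 * (2 * b^2 * x^2 + 2 * b * x + 1) - Q'))) (at x)"
      by (rule DERIV_add [OF DERIV_add [OF DERIV_minus [OF DERIV_cdivide
          [OF DERIV_cmult [OF eighth]]] DERIV_cmult [OF cubes]] mixed])
    also have "(\<lambda>q. - (b^2 * (upper_cut b q ^ 8 + lower_cut q ^ 8) / 30)
        + 2 / 9 * b * (upper_cut b q ^ 3 - lower_cut q ^ 3)
        + (lower_cut q * upper_cut b q * Q q - 1 / 48 * c\<^sup>2 * ln (lower_cut q + upper_cut b q)))
      = nu_mid b"
      by (simp add: nu_mid_def fun_eq_iff Let_def Q_def c_def power_divide)
    also have "- (b^2 * (4 * ?r ^ 6 + 4 * ?s ^ 6) / 30)
        + 2 / 9 * b * (3 / 2 * ?r - 3 / 2 * ?s)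
        + ?s * ?r * (Q' + (2 / 15 * (2 * b^2 * x^2 + 2 * b * x + 1) - Q'))
      = b * (?r - ?s) * moment_clip b x"
      using br s(2) unfolding moment_clip_def Let_def by algebra
    finally show "(nu_mid b has_real_derivative
      b * (upper_cut b x - lower_cut x) * moment_clip b x) (at x)" .
  qed
  show "((\<lambda>q. b * (upper_cut b q - lower_cut q) * square_clip b q) has_integral
      xi_mid b (1 - 1 / b) - xi_mid b 0) {0..1 - 1 / b}"
    by (rule has_integral_piece [OF le cont(1) deriv(1)])
  show "((\<lambda>q. b * (upper_cut b q - lower_cut q) * moment_clip b q) has_integral
      nu_mid b (1 - 1 / b) - nu_mid b 0) {0..1 - 1 / b}"
    by (rule has_integral_piece [OF le cont(2) deriv(2)])
qed

section \<open>Summing the three pieces to the closed forms\<close>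

lemma has_integral_small:
  assumes b: "0 < b" "b \<le> 1"
  shows "((\<lambda>q. b * (upper_cut b q - lower_cut q) * square_clip b q) has_integral (Xi b + 2) / 6)
      {- (1 / b)..1}"
    and "((\<lambda>q. b * (upper_cut b q - lower_cut q) * moment_clip b q) has_integral (Nu b + 2) / 12)
      {- (1 / b)..1}"
proof -
  have ends: "upper_cut b (- (1 / b)) = 0" "upper_cut b (1 - 1 / b) = 1" "lower_cut 0 = 0"
    by (simp_all add: upper_cut_def lower_cut_def)
  \<comment> \<open>For b <= 1 the break points are ordered -1/b, 1 - 1/b, 0, 1.\<close>
  have le: "1 - 1 / b \<le> 0" "- (1 / b) \<le> 1 - 1 / b"
    using b by simp_all
  have le': "- (1 / b) \<le> 0"
    using b by simp
  have left: "((\<lambda>q. b * (upper_cut b q - lower_cut q) * square_clip b q) has_integral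
      xi_left b 1 - xi_left b 0) {- (1 / b)..1 - 1 / b}"
    "((\<lambda>q. b * (upper_cut b q - lower_cut q) * moment_clip b q) has_integral
      nu_left b 1 - nu_left b 0) {- (1 / b)..1 - 1 / b}"
    using has_integral_left [OF b(1) order_refl le(2) le(1) order_refl] by (simp_all only: ends)
  have right: "((\<lambda>q. b * (upper_cut b q - lower_cut q) * square_clip b q) has_integral
      xi_right b 1 - xi_right b 0) {0..1}"
    "((\<lambda>q. b * (upper_cut b q - lower_cut q) * moment_clip b q) has_integral
      nu_right b 1 - nu_right b 0) {0..1}"
    using has_integral_right [OF b(1) order_refl le(1) zero_le_one] by (simp_all only: ends)
  note mid = has_integral_mid_small [OF b]
  have "(xi_left b 1 - xi_left b 0)
      + - (b^3 * ((1 - 1 / b) / 5 - (1 - 1 / b)^2 / 3 + (1 - 1 / b)^3 / 3))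
      + (xi_right b 1 - xi_right b 0) = (Xi b + 2) / 6"
    using b unfolding xi_left_def xi_right_def Xi_def Xi_small_def
    by (simp add: field_simps eval_nat_numeral)
  with has_integral_combine [OF le' zero_le_one has_integral_combine [OF le(2) le(1) left(1) mid(1)]
      right(1)]
  show "((\<lambda>q. b * (upper_cut b q - lower_cut q) * square_clip b q) has_integral (Xi b + 2) / 6)
      {- (1 / b)..1}"
    by (simp only:)
  have "(nu_left b 1 - nu_left b 0) + - (b^2 * ((1 - 1 / b) / 5 - (1 - 1 / b)^2 / 6))
      + (nu_right b 1 - nu_right b 0) = (Nu b + 2) / 12"
    using b unfolding nu_left_def nu_right_def Nu_def Nu_small_def
    by (simp add: field_simps eval_nat_numeral)
  with has_integral_combine [OF le' zero_le_one has_integral_combine [OF le(2) le(1) left(2) mid(2)]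
      right(2)]
  show "((\<lambda>q. b * (upper_cut b q - lower_cut q) * moment_clip b q) has_integral (Nu b + 2) / 12)
      {- (1 / b)..1}"
    by (simp only:)
qed

text \<open>The left side is ln (s + r) at q = 1 - 1/b, and sqrt b (gam b + 1) = sqrt b + sqrt (b -
  1) is the argument of the logarithm in acosh (sqrt b). The last summand is ln (s + r) at q =
  0.\<close>

lemma ln_one_plus_gam:
  assumes b: "1 < b"
  shows "ln (gam b + 1) = arcosh (sqrt b) + ln (sqrt (1 / b))"
proof -
  have "sqrt b * gam b = sqrt (b - 1)"
    using b by (simp add: gam_def flip: real_sqrt_mult)
  then have "arcosh (sqrt b) = ln (sqrt b * (gam b + 1))"
    using b by (simp add: arcosh_real_def algebra_simps)
  also have "\<dots> = ln (sqrt b) + ln (gam b + 1)"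
  proof -
    have "0 < gam b"
      using b by (simp add: gam_def)
    then show ?thesis
      using b by (simp add: ln_mult)
  qed
  also have "ln (sqrt b) = - ln (sqrt (1 / b))"
    using b by (simp add: real_sqrt_divide ln_div)
  finally show ?thesis
    by simp
qed

lemma has_integral_large:
  assumes b1: "1 < b"
  shows "((\<lambda>q. b * (upper_cut b q - lower_cut q) * square_clip b q) has_integral
      (Xi_large b + 2) / 6) {- (1 / b)..1}"
    and "((\<lambda>q. b * (upper_cut b q - lower_cut q) * moment_clip b q) has_integral
      (Nu_large b + 2) / 12) {- (1 / b)..1}"
proof -
  have b: "0 < b"
    using b1 by simp
  define \<rho> where "\<rho> = sqrt (1 / b)"
  define g where "g = gam b"
  have ends: "upper_cut b (- (1 / b)) = 0" "upper_cut b 0 = \<rho>" "upper_cut b (1 - 1 / b) = 1"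
      "lower_cut 0 = 0" "lower_cut (1 - 1 / b) = g"
    using b1 by (simp_all add: upper_cut_def lower_cut_def gam_def g_def \<rho>_def diff_divide_distrib)
  \<comment> \<open>For b > 1 the two inner break points change places: -1/b, 0, 1 - 1/b, 1.\<close>
  have le: "- (1 / b) \<le> 0" "0 \<le> 1 - 1 / b" "- (1 / b) \<le> 1 - 1 / b" "1 - 1 / b \<le> 1"
    using b1 by simp_all
  have left: "((\<lambda>q. b * (upper_cut b q - lower_cut q) * square_clip b q) has_integral
      xi_left b \<rho> - xi_left b 0) {- (1 / b)..0}"
    "((\<lambda>q. b * (upper_cut b q - lower_cut q) * moment_clip b q) has_integral
      nu_left b \<rho> - nu_left b 0) {- (1 / b)..0}"
    using has_integral_left [OF b order_refl le(1) order_refl le(2)] by (simp_all only: ends)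
  have right: "((\<lambda>q. b * (upper_cut b q - lower_cut q) * square_clip b q) has_integral
      xi_right b 1 - xi_right b g) {1 - 1 / b..1}"
    "((\<lambda>q. b * (upper_cut b q - lower_cut q) * moment_clip b q) has_integral
      nu_right b 1 - nu_right b g) {1 - 1 / b..1}"
    using has_integral_right [OF b le(2) order_refl le(4)] by (simp_all only: ends)
  note mid = has_integral_mid_large [OF b1]
  \<comment> \<open>These relations make the final sums polynomial identities in b, c, g, \<rho> and
    the two logarithms.\<close>
  define c where "c = 1 / b"
  have c: "b * c = 1" "g\<^sup>2 = 1 - c" "\<rho>\<^sup>2 = c"
    using b1 by (simp_all add: c_def g_def gam_def \<rho>_def diff_divide_distrib)
  \<comment> \<open>\<open>M\<close> occurs at both ends of the middle interval and cancels, leaving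
    only the acosh term \<open>L\<close>. Likewise the terms in \<rho>^3 cancel between the left and
    the middle piece.\<close>
  define L M where "L = arcosh (sqrt b)" and "M = ln \<rho>"
  have ln: "ln (g + 1) = L + M"
    using ln_one_plus_gam [OF b1] by (simp add: L_def M_def g_def \<rho>_def)
  have Xi: "Xi_large b = (183 * g - 38 * b * g - 88 * b^2 * g + 112 * b^2
      + 48 * b^3 * g - 48 * b^3 - 105 * (c * L)) / 210"
    by (simp add: Xi_large_def g_def c_def L_def)
  have Nu: "Nu_large b = (87 * (g * c) + 250 * g - 376 * b * g + 448 * b
      + 144 * b^2 * g - 144 * b^2 - 105 * (c^2 * L)) / 420"
    by (simp add: Nu_large_def g_def c_def L_def power_divide)
  have xi1: "xi_mid b (1 - 1 / b) = 4 / 15 * b^3 * (1 - c)^4 + 4 / 45 * b^2 * (1 - c)^3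
      - 8 / 15 * b * (1 - c)^2 - 4 / 5 * (1 - c) + 2 / 3 * b * (1 - g^3)
      + g * (- 4 / 15 * b^3 * (1 - c)^3 + 2 / 45 * b^2 * (1 - c)^2 + 43 / 90 * b * (1 - c) + 1 / 12)
      - 1 / 12 * c * (L + M)"
    unfolding xi_mid_def ends Let_def ln by (simp add: c_def)
  have xi0: "xi_mid b 0 = 2 / 3 * b * \<rho>^3 - 1 / 12 * c * M"
    unfolding xi_mid_def ends Let_def by (simp add: c_def M_def)
  have nu1: "nu_mid b (1 - 1 / b) = - (b^2 * (1 + g^8) / 30) + 2 / 9 * b * (1 - g^3)
      + g * (b^2 * (1 - c)^3 / 15 + b * (1 - c)^2 / 10 + 3 / 40 * (1 - c) + 1 / 48 * c)
      - 1 / 48 * c^2 * (L + M)"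
    unfolding nu_mid_def ends Let_def ln by (simp add: c_def power_divide)
  have nu0: "nu_mid b 0 = - (b^2 * \<rho>^8 / 30) + 2 / 9 * b * \<rho>^3 - 1 / 48 * c^2 * M"
    unfolding nu_mid_def ends Let_def by (simp add: c_def M_def power_divide)
  have "(xi_left b \<rho> - xi_left b 0) + (xi_mid b (1 - 1 / b) - xi_mid b 0)
      + (xi_right b 1 - xi_right b g) = (Xi_large b + 2) / 6"
  proof -
    have "xi_left b 0 = 0"
      "xi_right b 1 = 2 * b^3 * (1 / 10 - 1 / 15 - 1 / 6 + 2 / 15 + 1 / 6 - 23 / 105 + 1 / 15)"
      by (simp_all add: xi_left_def xi_right_def)
    then show ?thesis
      unfolding Xi xi1 xi0 xi_left_def [of b \<rho>] xi_right_def [of b g] using c by algebra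
  qed
  with has_integral_combine [OF le(3,4) has_integral_combine [OF le(1,2) left(1) mid(1)] right(1)]
  show "((\<lambda>q. b * (upper_cut b q - lower_cut q) * square_clip b q) has_integral
      (Xi_large b + 2) / 6) {- (1 / b)..1}"
    by (simp only:)
  have "(nu_left b \<rho> - nu_left b 0) + (nu_mid b (1 - 1 / b) - nu_mid b 0)
      + (nu_right b 1 - nu_right b g) = (Nu_large b + 2) / 12"
  proof -
    have "nu_left b 0 = 0"
      "nu_right b 1 = 2 * b^2 * (1 / 10 - 1 / 15 - 1 / 12 + 1 / 15 + 2 / 105 - 1 / 60)"
      by (simp_all add: nu_left_def nu_right_def)
    then show ?thesis
      unfolding Nu nu1 nu0 nu_left_def [of b \<rho>] nu_right_def [of b g] using c by algebra
  qed
  with has_integral_combine [OF le(3,4) has_integral_combine [OF le(1,2) left(2) mid(2)] right(2)]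
  show "((\<lambda>q. b * (upper_cut b q - lower_cut q) * moment_clip b q) has_integral
      (Nu_large b + 2) / 12) {- (1 / b)..1}"
    by (simp only:)
qed

text \<open>The integrals are stated as (Xi b + 2) / 6 and (Nu b + 2) / 12 to undo 6 I - 2 and 12 I
  - 2.\<close>

lemma xi_nu_C_fam:
  assumes b: "0 < b"
  shows "chatterjee_xi (C_fam b) = Xi b" "blest_nu (C_fam b) = Nu b"
proof -
  have int: "((\<lambda>q. b * (upper_cut b q - lower_cut q) * square_clip b q) has_integral
      (Xi b + 2) / 6) {- (1 / b)..1}"
    "((\<lambda>q. b * (upper_cut b q - lower_cut q) * moment_clip b q) has_integral
      (Nu b + 2) / 12) {- (1 / b)..1}"
    using has_integral_small [OF b] has_integral_large [of b]
    by (cases "b \<le> 1"; simp add: Xi_def Nu_def)+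
  show "chatterjee_xi (C_fam b) = Xi b" "blest_nu (C_fam b) = Nu b"
    using chatterjee_xi_C_fam [OF b int(1)] blest_nu_C_fam [OF b int(2)] by (simp_all add: field_simps)
qed

theorem theorem2p3:
  shows "(\<forall>b::real. 0 < b \<longrightarrow>
            chatterjee_xi (C_fam b) = Xi b \<and> blest_nu (C_fam b) = Nu b)
       \<and> Xi_small 1 = Xi_large 1
       \<and> Nu_small 1 = Nu_large 1
       \<and> chatterjee_xi (C_fam 1) = 32 / 105
       \<and> blest_nu (C_fam 1) = 76 / 105"
proof -
  \<comment> \<open>At b = 1 all terms with the root or the acosh vanish, leaving (112 - 48) / 210
    and (448 - 144) / 420.\<close>
  have "gam 1 = 0" "arcosh (sqrt 1) = (0 :: real)"
    by (simp_all add: gam_def)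
  then show ?thesis
    using xi_nu_C_fam
    by (simp add: Xi_def Nu_def Xi_small_def Nu_small_def Xi_large_def Nu_large_def)
qed

end
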